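(* Let $\alpha=\sum_{i=1}^n a_i\delta_{x_i}$ be a positive discrete measure on $\mathbb{R}^d$, with $a\in\mathbb{R}_+^n$. For a symmetric positive definite matrix $A\in\mathbb{R}^{d\times d}$ (a dilation transform matrix), let the dilation of $\alpha$ be $$\alpha_A=\sum_{i=1}^n a_i\,\delta_{Ax_i},$$ and let $\lambda_1,\dots,\lambda_d$ be the eigenvalues of $A$. Then $J(\lambda_1,\dots,\lambda_d):=J(\alpha_A;\alpha)$ is convex with respect to $\lambda_1,\dots,\lambda_d$; that is, for every fixed orthogonal matrix $Q\in\mathbb{R}^{d\times d}$, writing $A=Q\,\mathrm{diag}(\lambda_1,\dots,\lambda_d)\,Q^{T}$, the function $(\lambda_1,\dots,\lambda_d)\mapsto J(\alpha_A;\alpha)$ is convex on $(0,\infty)^d$. Here $J(\cdot\,;\cdot)$ is the objective function defined in the context.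
   Context: A positive discrete measure on $\mathbb{R}^d$ ($d\ge 1$) is a measure $\alpha=\sum_{i=1}^n a_i\delta_{x_i}$ with $x_i\in\mathbb{R}^d$ and $a=(a_1,\dots,a_n)\in\mathbb{R}_+^n$ (nonnegative entries), $\|a\|_1=\sum_i a_i>0$. Its normalization is the probability measure $\hat\alpha=\sum_{i=1}^n \hat a_i\delta_{x_i}$ with $\hat a_i=a_i/\|a\|_1$; similarly for $\beta=\sum_{j=1}^m b_j\delta_{y_j}$, $\hat b_j=b_j/\|b\|_1$. For discrete probability measures $\mu=\sum_{i=1}^n p_i\delta_{x_i}$ and $\nu=\sum_{j=1}^m q_j\delta_{y_j}$ on $\mathbb{R}^d$, the squared 2-Wasserstein distance is $$W_2^2(\mu,\nu)=\min\Big\{\sum_{i,j}|x_i-y_j|^2P_{i,j}\ :\ P\in\mathbb{R}_+^{n\times m},\ \sum_j P_{i,j}=p_i\ \forall i,\ \sum_i P_{i,j}=q_j\ \forall j\Big\},$$ with $|\cdot|$ the Euclidean norm. The objective function is $$J(\alpha;\beta)=W_2^2(\hat\alpha,\hat\beta)+\big(\|a\|_1-\|b\|_1\big)^2.$$ *)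

theory Defs
  imports "HOL-Analysis.Analysis"
begin

text \<open>
  The pair \<open>(a, x)\<close> stands for the discrete measure \<open>\<Sum>\<^sub>i a\<^sub>i \<delta>\<^bsub>x\<^sub>i\<^esub>\<close> on \<open>\<real>\<^sup>d\<close>; the number of
  atoms is \<open>CARD('n)\<close>, the dimension is \<open>CARD('d)\<close>. As in the usual presentation of discrete optimal
  transport, the points need not be distinct and weights may vanish.
\<close>

type_synonym ('n, 'd) discrete_measure = "(real^'n) \<times> ('n \<Rightarrow> real^'d)"

definition l1_norm :: "real^'n \<Rightarrow> real" where
  "l1_norm a = (\<Sum>i\<in>UNIV. \<bar>a $ i\<bar>)"

definition positive_measure :: "('n::finite, 'd::finite) discrete_measure \<Rightarrow> bool" where
  "positive_measure \<alpha> \<longleftrightarrow> (\<forall>i. 0 \<le> fst \<alpha> $ i) \<and> 0 < l1_norm (fst \<alpha>)"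

definition normalization :: "('n::finite, 'd::finite) discrete_measure \<Rightarrow> ('n, 'd) discrete_measure" where
  "normalization \<alpha> = ((1 / l1_norm (fst \<alpha>)) *\<^sub>R fst \<alpha>, snd \<alpha>)"

definition couplings :: "real^'n \<Rightarrow> real^'m \<Rightarrow> (real^'m^'n) set" where
  "couplings p q = {P. (\<forall>i j. 0 \<le> P $ i $ j) \<and>
                       (\<forall>i. (\<Sum>j\<in>UNIV. P $ i $ j) = p $ i) \<and>
                       (\<forall>j. (\<Sum>i\<in>UNIV. P $ i $ j) = q $ j)}"

definition transport_cost ::
    "('n::finite \<Rightarrow> real^'d::finite) \<Rightarrow> ('m::finite \<Rightarrow> real^'d) \<Rightarrow> real^'m^'n \<Rightarrow> real" where
  "transport_cost x y P = (\<Sum>i\<in>UNIV. \<Sum>j\<in>UNIV. (norm (x i - y j))\<^sup>2 * P $ i $ j)"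

text \<open>
  The squared 2-Wasserstein distance of two discrete probability measures. It is a minimum:
  see \<open>W2_sq_attained\<close> below.
\<close>

definition W2_sq :: "('n::finite, 'd::finite) discrete_measure \<Rightarrow> ('m::finite, 'd) discrete_measure \<Rightarrow> real" where
  "W2_sq \<mu> \<nu> = (INF P \<in> couplings (fst \<mu>) (fst \<nu>). transport_cost (snd \<mu>) (snd \<nu>) P)"

definition objective :: "('n::finite, 'd::finite) discrete_measure \<Rightarrow> ('m::finite, 'd) discrete_measure \<Rightarrow> real" where
  "objective \<alpha> \<beta> =
     W2_sq (normalization \<alpha>) (normalization \<beta>) + (l1_norm (fst \<alpha>) - l1_norm (fst \<beta>))\<^sup>2"

definition dilation :: "real^'d^'d \<Rightarrow> ('n::finite, 'd::finite) discrete_measure \<Rightarrow> ('n, 'd) discrete_measure" where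
  "dilation A \<alpha> = (fst \<alpha>, \<lambda>i. A *v snd \<alpha> i)"

definition diag_matrix :: "real^'d \<Rightarrow> real^'d^'d" where
  "diag_matrix l = (\<chi> i j. if i = j then l $ i else 0)"

definition spectral_matrix :: "real^'d^'d \<Rightarrow> real^'d \<Rightarrow> real^'d^'d" where
  "spectral_matrix Q l = Q ** diag_matrix l ** transpose Q"

lemma W2_sq_attained:
  fixes \<mu> :: "('n::finite, 'd::finite) discrete_measure" and \<nu> :: "('m::finite, 'd) discrete_measure"
  assumes "\<And>i. 0 \<le> fst \<mu> $ i" "\<And>j. 0 \<le> fst \<nu> $ j"
    and "(\<Sum>i\<in>UNIV. fst \<mu> $ i) = 1" "(\<Sum>j\<in>UNIV. fst \<nu> $ j) = 1"
  obtains P where "P \<in> couplings (fst \<mu>) (fst \<nu>)"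
    and "transport_cost (snd \<mu>) (snd \<nu>) P = W2_sq \<mu> \<nu>"
    and "\<And>P'. P' \<in> couplings (fst \<mu>) (fst \<nu>) \<Longrightarrow> W2_sq \<mu> \<nu> \<le> transport_cost (snd \<mu>) (snd \<nu>) P'"
proof -
  let ?p = "fst \<mu>" and ?q = "fst \<nu>"
  let ?C = "couplings ?p ?q" and ?c = "transport_cost (snd \<mu>) (snd \<nu>)"
  have "(\<chi> i j. ?p $ i * ?q $ j) \<in> ?C"
    using assms by (auto simp: couplings_def simp flip: sum_distrib_left sum_distrib_right)
  then have ne: "?C \<noteq> {}" by blast
  have "closed ?C"
    unfolding couplings_def
    by (intro closed_Collect_conj closed_Collect_all closed_Collect_le closed_Collect_eq continuous_intros)
  moreover have "bounded ?C"
  proof -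
    have "norm P \<le> 1" if "P \<in> ?C" for P
    proof -
      have "norm P \<le> (\<Sum>i\<in>UNIV. norm (P $ i))"
        by (simp add: norm_vec_def L2_set_le_sum)
      also have "\<dots> \<le> (\<Sum>i\<in>UNIV. \<Sum>j\<in>UNIV. \<bar>P $ i $ j\<bar>)"
        by (intro sum_mono norm_le_l1_cart)
      also have "\<dots> = 1"
        using that assms by (simp add: couplings_def)
      finally show ?thesis .
    qed
    then show ?thesis by (auto simp: bounded_iff)
  qed
  ultimately have "compact ?C" by (simp add: compact_eq_bounded_closed)
  moreover have "continuous_on ?C ?c"
    unfolding transport_cost_def by (intro continuous_intros)
  ultimately obtain P where P: "P \<in> ?C" "\<And>P'. P' \<in> ?C \<Longrightarrow> ?c P \<le> ?c P'"
    using continuous_attains_inf[OF _ ne] by blast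
  have "W2_sq \<mu> \<nu> = ?c P"
    unfolding W2_sq_def by (rule cInf_eq_minimum) (use P in auto)
  with P that show thesis by auto
qed

text \<open>
  For orthogonal \<open>Q\<close> and \<open>l\<close> in the open positive orthant, \<open>spectral_matrix Q l\<close> is symmetric
  positive definite, with eigenvalues \<open>l\<close> (the columns of \<open>Q\<close> being eigenvectors).
\<close>

lemma spectral_matrix_sym_pos_def:
  fixes Q :: "real^'d^'d::finite"
  assumes Q: "orthogonal_matrix Q"
  shows "transpose (spectral_matrix Q l) = spectral_matrix Q l"
    and "spectral_matrix Q l *v column k Q = l $ k *\<^sub>R column k Q"
    and "(\<And>k. 0 < l $ k) \<Longrightarrow> v \<noteq> 0 \<Longrightarrow> 0 < v \<bullet> (spectral_matrix Q l *v v)"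
proof -
  have tD: "transpose (diag_matrix l) = diag_matrix l"
    by (auto simp: diag_matrix_def transpose_def vec_eq_iff)
  have D: "diag_matrix l *v w = (\<chi> i. l $ i * w $ i)" for w
    by (simp add: diag_matrix_def matrix_vector_mult_def vec_eq_iff if_distrib[of "\<lambda>x. x * _"] cong: if_cong)
  have QQ: "transpose Q ** Q = mat 1" "Q ** transpose Q = mat 1"
    using Q by (auto simp: orthogonal_matrix_def)
  show "transpose (spectral_matrix Q l) = spectral_matrix Q l"
    by (simp add: spectral_matrix_def matrix_transpose_mul tD matrix_mul_assoc)
  have c: "column k Q = Q *v axis k 1"
    by (simp add: matrix_vector_mult_basis)
  have "diag_matrix l *v axis k 1 = l $ k *\<^sub>R axis k 1"
    by (auto simp: D axis_def vec_eq_iff)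
  moreover have "transpose Q *v (Q *v axis k 1) = axis k 1"
    by (simp add: matrix_vector_mul_assoc QQ)
  ultimately show "spectral_matrix Q l *v column k Q = l $ k *\<^sub>R column k Q"
    by (simp add: spectral_matrix_def c matrix_vector_mult_scaleR flip: matrix_vector_mul_assoc)
  assume l: "\<And>k. 0 < l $ k" and v: "v \<noteq> 0"
  define w where "w = transpose Q *v v"
  have "Q *v w = v"
    by (simp add: w_def matrix_vector_mul_assoc QQ del: transpose_matrix_vector)
  then have "w \<noteq> 0" using v by auto
  then obtain i where i: "w $ i \<noteq> 0" by (auto simp: vec_eq_iff)
  have "v \<bullet> (spectral_matrix Q l *v v) = w \<bullet> (diag_matrix l *v w)"
    by (simp add: spectral_matrix_def w_def dot_lmul_matrix transpose_matrix_vector flip: matrix_vector_mul_assoc)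
  also have "\<dots> = (\<Sum>i\<in>UNIV. l $ i * (w $ i)\<^sup>2)"
    by (simp add: D inner_vec_def power2_eq_square mult_ac)
  also have "\<dots> > 0"
    by (rule sum_pos2[of _ i]) (use i l in \<open>auto simp: less_imp_le\<close>)
  finally show "0 < v \<bullet> (spectral_matrix Q l *v v)" .
qed

end

theory Submission
  imports Defs
begin

text \<open>
  A positive semidefinite dilation is the gradient of a convex function, so the optimal coupling of
  \<open>\<alpha>\<^sub>A\<close> and \<open>\<alpha>\<close> is the diagonal one, with Kantorovich potential \<open>x \<mapsto> |x|\<^sup>2 - \<langle>x, A x\<rangle>\<close>. Hence
  \<open>J(\<alpha>\<^sub>A; \<alpha>)\<close> is the average of \<open>|A x\<^sub>i - x\<^sub>i|\<^sup>2\<close>, a sum of squared norms of affine functions of the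
  eigenvalues.
\<close>

text \<open>Expanding the squares, the right side minus the left is exactly the quadratic form of
  \<open>A\<close> at \<open>x - y\<close>. It vanishes at \<open>y = x\<close>, so the potential is
  tight on the diagonal coupling.\<close>

lemma dual_potential_inequality:
  fixes A :: "real^'d^'d::finite"
  assumes sym: "transpose A = A" and psd: "\<And>v. 0 \<le> v \<bullet> (A *v v)"
  shows "(norm (A *v x - x))\<^sup>2 + (y \<bullet> y - y \<bullet> (A *v y)) - (x \<bullet> x - x \<bullet> (A *v x))
         \<le> (norm (A *v x - y))\<^sup>2"
proof -
  have "x \<bullet> (A *v y) = y \<bullet> (A *v x)"
    by (metis sym dot_lmul_matrix transpose_matrix_vector inner_commute)
  then show ?thesis
    using psd[of "x - y"]
    by (simp add: power2_norm_eq_inner matrix_vector_mult_diff_distrib inner_diff_left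
        inner_diff_right inner_commute)
qed

text \<open>Weak duality: summing the potential inequality against any coupling bounds its cost
  below by that of the diagonal coupling.\<close>

lemma W2_sq_psd_dilation:
  fixes p :: "real^'n::finite" and x :: "'n \<Rightarrow> real^'d::finite"
  assumes p: "\<And>i. 0 \<le> p $ i"
    and A: "transpose A = A" "\<And>v. 0 \<le> v \<bullet> (A *v v)"
  shows "W2_sq (p, \<lambda>i. A *v x i) (p, x) = (\<Sum>i\<in>UNIV. p $ i * (norm (A *v x i - x i))\<^sup>2)"
proof -
  \<comment> \<open>The plan that matches each \<open>A *v x i\<close> with its own preimage
    \<open>x i\<close>.\<close>
  let ?D = "\<chi> i j. if i = j then p $ i else 0"
  let ?c = "transport_cost (\<lambda>i. A *v x i) x"
  let ?f = "\<lambda>i. (norm (A *v x i - x i))\<^sup>2"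
  have D: "?D \<in> couplings p p"
    using p by (auto simp: couplings_def)
  have cost_D: "?c ?D = (\<Sum>i\<in>UNIV. p $ i * ?f i)"
    by (simp add: transport_cost_def if_distrib[of "\<lambda>t. _ * t"] cong: if_cong)
      (simp add: mult.commute)
  have "?c ?D \<le> ?c P" if "P \<in> couplings p p" for P
  proof -
    have P: "\<And>i j. 0 \<le> P $ i $ j" "\<And>i. (\<Sum>j\<in>UNIV. P $ i $ j) = p $ i"
        "\<And>j. (\<Sum>i\<in>UNIV. P $ i $ j) = p $ j"
      using that by (auto simp: couplings_def)
    define g where "g i = x i \<bullet> x i - x i \<bullet> (A *v x i)" for i
    have row: "(\<Sum>i\<in>UNIV. \<Sum>j\<in>UNIV. h i * P $ i $ j) = (\<Sum>i\<in>UNIV. h i * p $ i)" for h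
      by (simp add: P flip: sum_distrib_left)
    have "(\<Sum>i\<in>UNIV. \<Sum>j\<in>UNIV. g j * P $ i $ j) = (\<Sum>i\<in>UNIV. g i * p $ i)"
      by (subst sum.swap) (simp add: P flip: sum_distrib_left)
    \<comment> \<open>Both marginals of \<open>P\<close> are \<open>p\<close>, so the two potential
      terms cancel and only the \<open>?f\<close> part remains.\<close>
    then have "?c ?D = (\<Sum>i\<in>UNIV. \<Sum>j\<in>UNIV. (?f i + g j - g i) * P $ i $ j)"
      by (simp add: cost_D row[of ?f] row[of g] sum.distrib sum_subtractf distrib_right
          left_diff_distrib mult.commute[of "p $ _"])
    also have "\<dots> \<le> ?c P"
      unfolding transport_cost_def
      by (intro sum_mono mult_right_mono P(1))
        (use dual_potential_inequality[OF A] in \<open>simp add: g_def\<close>)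
    finally show ?thesis .
  qed
  then have "W2_sq (p, \<lambda>i. A *v x i) (p, x) = ?c ?D"
    unfolding W2_sq_def by (intro cInf_eq_minimum) (use D in auto)
  with cost_D show ?thesis by simp
qed

lemma convex_on_norm_squared:
  "convex_on UNIV (\<lambda>v :: 'a::real_inner. (norm v)\<^sup>2)"
proof (rule convex_onI)
  fix t :: real and a b :: 'a
  assume "0 < t" "t < 1"
  \<comment> \<open>This is exactly the convexity gap of the squared norm.\<close>
  then have "0 \<le> t * (1 - t) * ((a - b) \<bullet> (a - b))"
    by simp
  also have "\<dots> = (1 - t) * (norm a)\<^sup>2 + t * (norm b)\<^sup>2 - (norm ((1 - t) *\<^sub>R a + t *\<^sub>R b))\<^sup>2"
    by (simp add: power2_norm_eq_inner inner_simps inner_commute algebra_simps)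
  finally show "(norm ((1 - t) *\<^sub>R a + t *\<^sub>R b))\<^sup>2 \<le> (1 - t) * (norm a)\<^sup>2 + t * (norm b)\<^sup>2"
    by simp
qed simp

lemma convex_on_finite_sum:
  fixes f :: "'i \<Rightarrow> 'a::real_vector \<Rightarrow> real"
  assumes "convex S" and "\<And>i. i \<in> I \<Longrightarrow> convex_on S (f i)"
  shows "convex_on S (\<lambda>x. \<Sum>i\<in>I. f i x)"
  using assms by (induction I rule: infinite_finite_induct) (auto simp: convex_on_const)

text \<open>With \<open>Q\<close> and \<open>x\<close> fixed, \<open>l\<close> only rescales the
  coordinates of \<open>transpose Q *v x\<close>.\<close>

lemma linear_spectral_matrix_apply:
  fixes Q :: "real^'d^'d::finite"
  shows "linear (\<lambda>l. spectral_matrix Q l *v x)"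
proof -
  have "diag_matrix l *v w = (\<chi> i. l $ i * w $ i)" for l w :: "real^'d"
    by (simp add: diag_matrix_def matrix_vector_mult_def vec_eq_iff if_distrib[of "\<lambda>x. x * _"]
        cong: if_cong)
  then have "linear (\<lambda>l. diag_matrix l *v w)" for w :: "real^'d"
    by (intro linearI) (simp_all add: vec_eq_iff algebra_simps)
  then have "linear ((*v) Q \<circ> (\<lambda>l. diag_matrix l *v (transpose Q *v x)))"
    by (intro linear_compose) auto
  then show ?thesis
    by (simp add: spectral_matrix_def o_def matrix_vector_mul_assoc matrix_mul_assoc
        del: transpose_matrix_vector)
qed

text \<open>Dilation keeps the weights, so the mass penalty is zero and both normalized measures
  have the same weight vector.\<close>

lemma objective_spectral_dilation:
  fixes \<alpha> :: "('n::finite, 'd::finite) discrete_measure"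
  assumes "positive_measure \<alpha>" and Q: "orthogonal_matrix Q" and l: "\<And>k. 0 < l $ k"
  shows "objective (dilation (spectral_matrix Q l) \<alpha>) \<alpha> =
    (\<Sum>i\<in>UNIV. fst \<alpha> $ i / l1_norm (fst \<alpha>) *
      (norm (spectral_matrix Q l *v snd \<alpha> i - snd \<alpha> i))\<^sup>2)"
proof -
  have "0 \<le> v \<bullet> (spectral_matrix Q l *v v)" for v
    using spectral_matrix_sym_pos_def(3)[OF Q l, of v] by (cases "v = 0") auto
  moreover have "0 \<le> ((1 / l1_norm (fst \<alpha>)) *\<^sub>R fst \<alpha>) $ i" for i
    using assms(1) by (simp add: positive_measure_def)
  ultimately show ?thesis
    using spectral_matrix_sym_pos_def(1)[OF Q]
    by (simp add: objective_def dilation_def normalization_def W2_sq_psd_dilation)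
qed

theorem proposition2p6:
  fixes \<alpha> :: "('n::finite, 'd::finite) discrete_measure"
    and Q :: "real^'d^'d"
  assumes "positive_measure \<alpha>"
    and "orthogonal_matrix Q"
  shows "convex_on {l :: real^'d. \<forall>k. 0 < l $ k}
           (\<lambda>l. objective (dilation (spectral_matrix Q l) \<alpha>) \<alpha>)"
proof -
  let ?S = "{l :: real^'d. \<forall>k. 0 < l $ k}"
  let ?L = "\<lambda>l i. spectral_matrix Q l *v snd \<alpha> i"
  let ?w = "\<lambda>i. fst \<alpha> $ i / l1_norm (fst \<alpha>)"
  have S: "convex ?S"
  proof -
    have "?S = (\<Inter>k. (\<lambda>l. l $ k) -` {0<..})"
      by auto
    then show ?thesis
      by (auto intro!: convex_INT convex_linear_vimage bounded_linear.linear
          bounded_linear_vec_nth convex_real_interval)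
  qed
  have "convex_on ?S (\<lambda>l. (norm (?L l i - snd \<alpha> i))\<^sup>2)" for i
  proof (rule convex_onI[OF _ S])
    fix t :: real and u v :: "real^'d"
    assume t: "0 < t" "t < 1"
    \<comment> \<open>The displacement is affine in \<open>l\<close>: the constant
      \<open>snd \<alpha> i\<close> is split with weights \<open>1 - t\<close> and
      \<open>t\<close>.\<close>
    have "?L ((1 - t) *\<^sub>R u + t *\<^sub>R v) i - snd \<alpha> i =
        (1 - t) *\<^sub>R (?L u i - snd \<alpha> i) + t *\<^sub>R (?L v i - snd \<alpha> i)"
      by (simp add: linear_add[OF linear_spectral_matrix_apply]
          linear_scale[OF linear_spectral_matrix_apply] scaleR_diff_right)
        (simp add: scaleR_diff_left)
    then show "(norm (?L ((1 - t) *\<^sub>R u + t *\<^sub>R v) i - snd \<alpha> i))\<^sup>2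
        \<le> (1 - t) * (norm (?L u i - snd \<alpha> i))\<^sup>2 + t * (norm (?L v i - snd \<alpha> i))\<^sup>2"
      using convex_onD[OF convex_on_norm_squared, of t] t by simp
  qed
  moreover have "0 \<le> ?w i" for i
    using assms(1) by (simp add: positive_measure_def)
  ultimately have sum: "convex_on ?S (\<lambda>l. \<Sum>i\<in>UNIV. ?w i * (norm (?L l i - snd \<alpha> i))\<^sup>2)"
    (is "convex_on _ ?F")
    using S by (intro convex_on_finite_sum convex_on_cmul)
  \<comment> \<open>The closed form is available only on the orthant, so convexity is transferred
    pointwise, at \<open>u\<close>, \<open>v\<close> and their convex combination.\<close>
  have F: "objective (dilation (spectral_matrix Q l) \<alpha>) \<alpha> = ?F l" if "l \<in> ?S" for l
    using that by (intro objective_spectral_dilation assms) auto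
  show ?thesis
  proof (rule convex_onI[OF _ S])
    fix t :: real and u v
    assume t: "0 < t" "t < 1" and uv: "u \<in> ?S" "v \<in> ?S"
    then have "(1 - t) *\<^sub>R u + t *\<^sub>R v \<in> ?S"
      by (intro convexD[OF S]) auto
    then show "objective (dilation (spectral_matrix Q ((1 - t) *\<^sub>R u + t *\<^sub>R v)) \<alpha>) \<alpha>
        \<le> (1 - t) * objective (dilation (spectral_matrix Q u) \<alpha>) \<alpha>
          + t * objective (dilation (spectral_matrix Q v) \<alpha>) \<alpha>"
      unfolding F[OF uv(1)] F[OF uv(2)] using convex_onD[OF sum, of t u v] t uv by (simp only: F)
  qed
qed

end
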